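(* Let $(H;\langle\cdot,\cdot\rangle)$ be an inner product space over the real or complex number field $\mathbb{K}$, let $\eta>0$ and let $x_i\in H$, $i\in\{1,\dots,n\}$, have the property that $$\|x_j-x_i\|\le\eta<\|x_j\|\qquad\text{for each }i,j\in\{1,\dots,n\}.$$ Then $$\sum_{i=1}^n\sqrt{\|x_i\|^2-\eta^2}\le\frac{\big\|\sum_{i=1}^n x_i\big\|^2}{\sum_{i=1}^n\|x_i\|}.$$ Equality holds in this last inequality if and only if $$\|x_i\|\sqrt{\|x_j\|^2-\eta^2}=\operatorname{Re}\langle x_i,x_j\rangle\qquad\text{for each }i,j\in\{1,\dots,n\}.$$
   Context: $n$ is a positive integer and $\|\cdot\|$ is the norm induced by the inner product. *)

theory Defs
  imports Complex_Main "HOL-Analysis.Inner_Product"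
begin

text \<open>
  The scalar fields are exactly the real and the complex numbers: the embedding \<open>to_complex\<close>
  is a (necessarily injective) field homomorphism whose image is either the real line or all
  of the complex plane.  Conjugation and real part of a scalar are those of its image.
\<close>

class real_or_complex = field +
  fixes to_complex :: "'a \<Rightarrow> complex"
  assumes to_complex_add: "to_complex (a + b) = to_complex a + to_complex b"
    and to_complex_mult: "to_complex (a * b) = to_complex a * to_complex b"
    and to_complex_one: "to_complex 1 = 1"
    and range_to_complex: "range to_complex = \<real> \<or> range to_complex = UNIV"

instantiation real :: real_or_complex
begin
definition to_complex_real :: "real \<Rightarrow> complex" where "to_complex_real = complex_of_real"
instance
  by standard (auto simp: to_complex_real_def Reals_def)
end

instantiation complex :: real_or_complex
begin
definition to_complex_complex :: "complex \<Rightarrow> complex" where "to_complex_complex = id"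
instance
  by standard (auto simp: to_complex_complex_def)
end

locale inner_product_space = vector_space scale
  for scale :: "'k::real_or_complex \<Rightarrow> 'h::ab_group_add \<Rightarrow> 'h" +
  fixes ip :: "'h \<Rightarrow> 'h \<Rightarrow> 'k"
  assumes ip_add_left: "ip (x + y) z = ip x z + ip y z"
    and ip_scale_left: "ip (scale a x) y = a * ip x y"
    and ip_commute: "to_complex (ip y x) = cnj (to_complex (ip x y))"
    and ip_ge_zero: "0 \<le> Re (to_complex (ip x x))"
    and ip_eq_zero_imp: "ip x x = 0 \<Longrightarrow> x = 0"

definition re_ip :: "('h \<Rightarrow> 'h \<Rightarrow> 'k::real_or_complex) \<Rightarrow> 'h \<Rightarrow> 'h \<Rightarrow> real" where
  "re_ip ip x y = Re (to_complex (ip x y))"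

text \<open>\<open>ip x x\<close> is real by conjugate symmetry, so taking the real part only changes its type.\<close>

definition ip_norm :: "('h \<Rightarrow> 'h \<Rightarrow> 'k::real_or_complex) \<Rightarrow> 'h \<Rightarrow> real" where
  "ip_norm ip x = sqrt (re_ip ip x x)"

text \<open>Over the reals, the class \<open>real_inner\<close> and its norm are an instance.\<close>

lemma inner_product_space_real_inner:
  "inner_product_space scaleR (inner :: 'h::real_inner \<Rightarrow> 'h \<Rightarrow> real)"
  by (intro inner_product_space.intro inner_product_space_axioms.intro
        real_vector.vector_space_axioms)
     (auto simp: to_complex_real_def inner_add_left intro: inner_commute)

lemma ip_norm_real_inner: "ip_norm (inner :: 'h::real_inner \<Rightarrow> 'h \<Rightarrow> real) x = norm x"
  by (simp add: ip_norm_def re_ip_def to_complex_real_def norm_eq_sqrt_inner)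

lemma inner_product_space_complex:
  "inner_product_space ((*) :: complex \<Rightarrow> complex \<Rightarrow> complex) (\<lambda>x y. x * cnj y)"
  by (intro inner_product_space.intro inner_product_space_axioms.intro vector_space.intro)
     (auto simp: to_complex_complex_def algebra_simps)

end

theory Submission
  imports Defs
begin

text \<open>
  Expanding \<open>\<parallel>x\<^sub>j - x\<^sub>i\<parallel>\<^sup>2 \<le> \<eta>\<^sup>2\<close> gives
  \<open>\<parallel>x\<^sub>i\<parallel>\<^sup>2 + (\<parallel>x\<^sub>j\<parallel>\<^sup>2 - \<eta>\<^sup>2) \<le> 2 Re \<langle>x\<^sub>i, x\<^sub>j\<rangle>\<close>, and the inequality between the arithmetic and
  geometric means bounds the left side below by \<open>2 \<parallel>x\<^sub>i\<parallel> sqrt (\<parallel>x\<^sub>j\<parallel>\<^sup>2 - \<eta>\<^sup>2)\<close>; this is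
  \<open>norm_mult_sqrt_le_re_ip\<close>. Summed over all pairs \<open>(i, j)\<close>, the resulting lower bounds for
  \<open>Re \<langle>x\<^sub>i, x\<^sub>j\<rangle>\<close> factor as \<open>(\<Sum> \<parallel>x\<^sub>i\<parallel>) (\<Sum> sqrt (\<parallel>x\<^sub>j\<parallel>\<^sup>2 - \<eta>\<^sup>2))\<close>, while the real parts add up to
  \<open>\<parallel>\<Sum> x\<^sub>i\<parallel>\<^sup>2\<close>. Dividing by \<open>\<Sum> \<parallel>x\<^sub>i\<parallel> > 0\<close> proves the inequality. Since it is a sum of inequalities,
  one for each pair, equality holds exactly when it holds for each pair.
\<close>

context inner_product_space
begin

lemma re_ip_add_left: "re_ip ip (x + y) z = re_ip ip x z + re_ip ip y z"
  by (simp add: re_ip_def ip_add_left to_complex_add)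

lemma re_ip_commute: "re_ip ip x y = re_ip ip y x"
  by (simp add: re_ip_def ip_commute[of x y])

text \<open>
  Additivity in each argument is packaged as \<open>additive\<close> so that differences and finite sums
  inside \<open>re_ip\<close> expand by the general facts about additive maps.
\<close>

lemma additive_re_ip_left: "additive (\<lambda>x. re_ip ip x z)"
  by (simp add: additive.intro re_ip_add_left)

lemma additive_re_ip_right: "additive (re_ip ip z)"
  by (simp add: additive.intro re_ip_commute[of z] re_ip_add_left)

lemma ip_norm_sq: "(ip_norm ip x)\<^sup>2 = re_ip ip x x"
  by (simp add: ip_norm_def re_ip_def ip_ge_zero)

lemma ip_norm_nonneg: "0 \<le> ip_norm ip x"
  by (simp add: ip_norm_def re_ip_def ip_ge_zero)

lemma ip_norm_diff_sq:
  "(ip_norm ip (y - x))\<^sup>2 = (ip_norm ip x)\<^sup>2 + (ip_norm ip y)\<^sup>2 - 2 * re_ip ip x y"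
  by (simp add: ip_norm_sq additive.diff[OF additive_re_ip_left]
      additive.diff[OF additive_re_ip_right] re_ip_commute[of y x])

lemma ip_norm_sum_sq:
  "(ip_norm ip (sum x A))\<^sup>2 = (\<Sum>i\<in>A. \<Sum>j\<in>A. re_ip ip (x i) (x j))"
  unfolding ip_norm_sq additive.sum[OF additive_re_ip_left]
    additive.sum[OF additive_re_ip_right] by (rule sum.swap)

text \<open>
  A reverse of the Cauchy--Schwarz inequality. Geometrically, the ball of radius \<open>\<eta>\<close> around \<open>y\<close>
  is seen from the origin within an angle \<open>\<theta>\<close> of \<open>y\<close>, where \<open>\<parallel>y\<parallel> sin \<theta> = \<eta>\<close>. A vector \<open>x\<close> in this
  ball thus has \<open>Re \<langle>x, y\<rangle> \<ge> \<parallel>x\<parallel> \<parallel>y\<parallel> cos \<theta>\<close>, and \<open>\<parallel>y\<parallel> cos \<theta>\<close> is the square root below.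
\<close>

lemma norm_mult_sqrt_le_re_ip:
  assumes "ip_norm ip (y - x) \<le> \<eta>" and "\<eta> \<le> ip_norm ip y"
  shows "ip_norm ip x * sqrt ((ip_norm ip y)\<^sup>2 - \<eta>\<^sup>2) \<le> re_ip ip x y"
proof -
  let ?a = "ip_norm ip x" and ?s = "sqrt ((ip_norm ip y)\<^sup>2 - \<eta>\<^sup>2)"
  have "0 \<le> \<eta>"
    using assms(1) ip_norm_nonneg order_trans by blast
  then have "?s\<^sup>2 = (ip_norm ip y)\<^sup>2 - \<eta>\<^sup>2"
    using power_mono[OF assms(2)] by simp
  moreover have "(ip_norm ip (y - x))\<^sup>2 \<le> \<eta>\<^sup>2"
    by (intro power_mono assms(1) ip_norm_nonneg)
  ultimately have "?a\<^sup>2 + ?s\<^sup>2 \<le> 2 * re_ip ip x y"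
    by (simp add: ip_norm_diff_sq)
  moreover have "2 * ?a * ?s \<le> ?a\<^sup>2 + ?s\<^sup>2"
    by (rule sum_squares_bound)
  ultimately show ?thesis by linarith
qed

end

text \<open>
  The equality case of adding inequalities: a sum of nonnegative gaps vanishes only if every gap
  does.
\<close>

lemma double_sum_eq_iff:
  fixes f g :: "'a \<Rightarrow> 'b \<Rightarrow> real"
  assumes "finite A" "finite B" and le: "\<And>i j. i \<in> A \<Longrightarrow> j \<in> B \<Longrightarrow> f i j \<le> g i j"
  shows "(\<Sum>i\<in>A. \<Sum>j\<in>B. f i j) = (\<Sum>i\<in>A. \<Sum>j\<in>B. g i j)
    \<longleftrightarrow> (\<forall>i\<in>A. \<forall>j\<in>B. f i j = g i j)"
proof -
  have "(\<Sum>i\<in>A. \<Sum>j\<in>B. f i j) = (\<Sum>i\<in>A. \<Sum>j\<in>B. g i j)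
    \<longleftrightarrow> (\<Sum>i\<in>A. \<Sum>j\<in>B. g i j - f i j) = 0"
    by (auto simp: sum_subtractf)
  also have "\<dots> \<longleftrightarrow> (\<forall>i\<in>A. \<forall>j\<in>B. g i j - f i j = 0)"
    using assms by (simp add: sum_nonneg_eq_0_iff sum_nonneg)
  finally show ?thesis by auto
qed

theorem theorem8:
  fixes scale :: "'k::real_or_complex \<Rightarrow> 'h::ab_group_add \<Rightarrow> 'h"
    and ip :: "'h \<Rightarrow> 'h \<Rightarrow> 'k"
    and n :: nat and \<eta> :: real and x :: "nat \<Rightarrow> 'h"
  assumes "inner_product_space scale ip"
    and "n \<ge> 1"
    and "\<eta> > 0"
    and "\<And>i j. i \<in> {1..n} \<Longrightarrow> j \<in> {1..n} \<Longrightarrow>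
           ip_norm ip (x j - x i) \<le> \<eta> \<and> \<eta> < ip_norm ip (x j)"
  shows "(\<Sum>i=1..n. sqrt ((ip_norm ip (x i))\<^sup>2 - \<eta>\<^sup>2))
           \<le> (ip_norm ip (\<Sum>i=1..n. x i))\<^sup>2 / (\<Sum>i=1..n. ip_norm ip (x i))
       \<and> ((\<Sum>i=1..n. sqrt ((ip_norm ip (x i))\<^sup>2 - \<eta>\<^sup>2))
             = (ip_norm ip (\<Sum>i=1..n. x i))\<^sup>2 / (\<Sum>i=1..n. ip_norm ip (x i))
          \<longleftrightarrow> (\<forall>i\<in>{1..n}. \<forall>j\<in>{1..n}.
                ip_norm ip (x i) * sqrt ((ip_norm ip (x j))\<^sup>2 - \<eta>\<^sup>2) = re_ip ip (x i) (x j)))"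
proof -
  interpret inner_product_space scale ip by (fact assms(1))
  let ?I = "{1..n}"
  let ?N = "\<Sum>i=1..n. ip_norm ip (x i)"
  let ?S = "\<Sum>i=1..n. sqrt ((ip_norm ip (x i))\<^sup>2 - \<eta>\<^sup>2)"
  let ?f = "\<lambda>i j. ip_norm ip (x i) * sqrt ((ip_norm ip (x j))\<^sup>2 - \<eta>\<^sup>2)"
  let ?g = "\<lambda>i j. re_ip ip (x i) (x j)"
  have pos: "0 < ip_norm ip (x i)" if "i \<in> ?I" for i
    using assms(3) assms(4)[OF that that] by linarith
  have "0 < ?N"
    using \<open>n \<ge> 1\<close> by (intro sum_pos pos) auto
  have le: "?f i j \<le> ?g i j" if "i \<in> ?I" "j \<in> ?I" for i j
    using assms(4)[OF that] by (intro norm_mult_sqrt_le_re_ip) auto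
  have lhs: "?S * ?N = (\<Sum>i\<in>?I. \<Sum>j\<in>?I. ?f i j)"
    by (subst mult.commute) (rule sum_product)
  have rhs: "(ip_norm ip (\<Sum>i=1..n. x i))\<^sup>2 = (\<Sum>i\<in>?I. \<Sum>j\<in>?I. ?g i j)"
    by (rule ip_norm_sum_sq)
  have "?S * ?N \<le> (ip_norm ip (\<Sum>i=1..n. x i))\<^sup>2"
    unfolding lhs rhs by (intro sum_mono le)
  moreover have "?S * ?N = (ip_norm ip (\<Sum>i=1..n. x i))\<^sup>2 \<longleftrightarrow> (\<forall>i\<in>?I. \<forall>j\<in>?I. ?f i j = ?g i j)"
    unfolding lhs rhs by (intro double_sum_eq_iff le) auto
  ultimately show ?thesis
    using \<open>0 < ?N\<close> by (simp add: pos_le_divide_eq eq_divide_eq)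
qed

end
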